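(* Let $\lambda\in(0,1]$, let $n\ge1$, and let $X_1,\dots,X_n$ be independent random variables with $X_i\sim DB_\lambda(\alpha_i,\theta)$ for $i=1,\dots,n$ (same $\theta$ for all $i$). Then \[ \sum_{i=1}^n X_i\sim DB_\lambda\Big(\sum_{i=1}^n\alpha_i,\theta\Big). \]
   Context: For nonzero real $\lambda$, the degenerate exponential is $e_\lambda^x(t)=(1+\lambda t)^{x/\lambda}=\sum_{n=0}^\infty \frac{(x)_{n,\lambda}}{n!}t^n$, with $e_\lambda(t)=e_\lambda^1(t)$, where $(x)_{0,\lambda}=1$ and $(x)_{n,\lambda}=x(x-\lambda)\cdots(x-(n-1)\lambda)$ for $n\ge1$. The degenerate Bell polynomials $\phi_{n,\lambda}(x)$ are defined by $e^{x(e_\lambda(t)-1)}=\sum_{n=0}^\infty \phi_{n,\lambda}(x)\frac{t^n}{n!}$. A discrete random variable $X$ taking values in $\{0,1,2,\dots\}$ has the degenerate Bell distribution with parameters $(\alpha,\theta)\in\mathbb{R}^2$, written $X\sim DB_\lambda(\alpha,\theta)$, if $P\{X=k\}=e^{-\alpha(e_\lambda(\theta)-1)}\frac{\theta^k}{k!}\phi_{k,\lambda}(\alpha)$ for all $k\ge0$ (parameters being such that these numbers form a probability mass function). *)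

theory Defs
  imports "HOL-Probability.Probability"
begin

text \<open>The degenerate falling factorial \<open>(x)\<^sub>n\<^sub>,\<^sub>\<lambda> = x (x - \<lambda>) \<dots> (x - (n - 1) \<lambda>)\<close>.\<close>

definition deg_falling :: "real \<Rightarrow> real \<Rightarrow> nat \<Rightarrow> real" where
  "deg_falling l x n = (\<Prod>i<n. x - real i * l)"

text \<open>
  Real powers \<open>b\<close> to the \<open>a\<close>, where \<open>b\<close> may be negative or zero if \<open>a\<close> is an integer.  For
  \<open>b > 0\<close> this is \<open>b powr a\<close>.  The extension matters because \<open>1 + \<lambda> \<theta>\<close> may be negative
  when \<open>1 / \<lambda>\<close> is an integer: for \<open>\<lambda> = 1\<close>, for instance, the degenerate exponential has
  to be \<open>1 + \<theta>\<close> for every real \<open>\<theta>\<close>, which \<open>(1 + \<theta>) powr 1\<close> is not.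
\<close>

definition real_pow :: "real \<Rightarrow> real \<Rightarrow> real" where
  "real_pow b a = (if a \<in> \<int> then b powi \<lfloor>a\<rfloor> else b powr a)"

lemma real_pow_eq_powr: "b > 0 \<Longrightarrow> real_pow b a = b powr a"
  by (auto simp: real_pow_def powr_real_of_int' elim!: Ints_cases)

text \<open>
  The degenerate exponential \<open>(1 + \<lambda> t)\<close> to the \<open>x / \<lambda>\<close>, once as a real function of \<open>t\<close>
  and once as a formal power series in \<open>t\<close>; the two are related by \<open>deg_exp_sums\<close> below.
\<close>

definition deg_exp :: "real \<Rightarrow> real \<Rightarrow> real \<Rightarrow> real" where
  "deg_exp l x t = real_pow (1 + l * t) (x / l)"

definition deg_exp_fps :: "real \<Rightarrow> real \<Rightarrow> real fps" where
  "deg_exp_fps l x = Abs_fps (\<lambda>n. deg_falling l x n / fact n)"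

lemma deg_falling_gbinomial:
  assumes "l \<noteq> 0"
  shows "deg_falling l x n / fact n = ((x / l) gchoose n) * l ^ n"
proof -
  have "deg_falling l x n = (\<Prod>i<n. l * (x / l - real i))"
    unfolding deg_falling_def using assms by (intro prod.cong) (auto simp: field_simps)
  also have "\<dots> = l ^ n * (\<Prod>i<n. x / l - real i)"
    by (simp add: prod.distrib)
  finally show ?thesis
    by (simp add: gbinomial_prod_rev atLeast0LessThan)
qed

lemma deg_exp_sums:
  assumes "l \<noteq> 0" "\<bar>l * t\<bar> < 1"
  shows "(\<lambda>n. fps_nth (deg_exp_fps l x) n * t ^ n) sums deg_exp l x t"
proof -
  have "(\<lambda>n. ((x / l) gchoose n) * (l * t) ^ n) sums (1 + l * t) powr (x / l)"
    using assms by (intro gen_binomial_real) auto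
  moreover have "1 + l * t > 0"
    using assms(2) by linarith
  ultimately show ?thesis
    using assms(1)
    by (simp add: deg_exp_fps_def deg_exp_def real_pow_eq_powr deg_falling_gbinomial
        power_mult_distrib mult.assoc)
qed

text \<open>
  The degenerate Bell polynomial \<open>\<phi>\<^sub>n\<^sub>,\<^sub>\<lambda>\<close> evaluated at \<open>x\<close>: \<open>n!\<close> times the coefficient of
  \<open>t ^ n\<close> in \<open>exp (x * (e\<^sub>\<lambda>(t) - 1))\<close>.  The inner series has constant term 0, as \<open>oo\<close> requires.
\<close>

definition deg_bell :: "real \<Rightarrow> nat \<Rightarrow> real \<Rightarrow> real" where
  "deg_bell l n x = fact n * fps_nth (fps_compose (fps_exp x) (deg_exp_fps l 1 - 1)) n"

lemma deg_exp_fps_minus_1_nth_0: "fps_nth (deg_exp_fps l x - 1) 0 = 0"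
  by (simp add: deg_exp_fps_def deg_falling_def)

definition deg_bell_mass :: "real \<Rightarrow> real \<Rightarrow> real \<Rightarrow> nat \<Rightarrow> real" where
  "deg_bell_mass l a \<theta> k =
     exp (- a * (deg_exp l 1 \<theta> - 1)) * (\<theta> ^ k / fact k) * deg_bell l k a"

text \<open>
  \<open>X \<sim> DB\<^sub>\<lambda>(a, \<theta>)\<close> on a probability space \<open>M\<close>.  That the parameters are admissible, i.e.
  that the masses are nonnegative and sum to 1, is implied, since they are the point
  probabilities of a random variable with values in the natural numbers.
\<close>

definition deg_bell_distributed ::
    "'a measure \<Rightarrow> ('a \<Rightarrow> nat) \<Rightarrow> real \<Rightarrow> real \<Rightarrow> real \<Rightarrow> bool" where
  "deg_bell_distributed M X l a \<theta> \<longleftrightarrow>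
     X \<in> measurable M (count_space UNIV) \<and>
     (\<forall>k. measure M {\<omega> \<in> space M. X \<omega> = k} = deg_bell_mass l a \<theta> k)"

lemma deg_bell_mass_pmf:
  assumes "prob_space M" "deg_bell_distributed M X l a \<theta>"
  shows "deg_bell_mass l a \<theta> k \<ge> 0" and "deg_bell_mass l a \<theta> sums 1"
proof -
  interpret prob_space M by fact
  have X [measurable]: "X \<in> measurable M (count_space UNIV)"
    and mass: "prob {\<omega> \<in> space M. X \<omega> = k} = deg_bell_mass l a \<theta> k" for k
    using assms(2) by (auto simp: deg_bell_distributed_def)
  show "deg_bell_mass l a \<theta> k \<ge> 0"
    using mass[of k] by (metis measure_nonneg)
  have "(\<lambda>k. prob {\<omega> \<in> space M. X \<omega> = k}) sums prob (\<Union>k. {\<omega> \<in> space M. X \<omega> = k})"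
    by (intro finite_measure_UNION) (auto simp: disjoint_family_on_def)
  also have "(\<Union>k. {\<omega> \<in> space M. X \<omega> = k}) = space M"
    by auto
  finally show "deg_bell_mass l a \<theta> sums 1"
    by (simp add: mass prob_space)
qed

end

theory Submission
  imports Defs
begin

text \<open>
  The mass function of \<open>DB\<^sub>\<lambda>(a, \<theta>)\<close> at \<open>k\<close> is, up to the factor \<open>\<theta> ^ k\<close>, the \<open>k\<close>-th
  coefficient of \<open>exp (a * (e\<^sub>\<lambda>(t) - 1))\<close> multiplied by a constant that is exponential in \<open>a\<close>.
  As the series is also exponential in \<open>a\<close>, convolution of masses adds the parameters.
  Only formal power series are involved, so convergence at \<open>\<theta>\<close> plays no role.
\<close>

text \<open>\<open>fps_exp (a + b)\<close> is the product of \<open>fps_exp a\<close> and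
  \<open>fps_exp b\<close>, and composition with a series of zero constant term preserves products.
  Dividing by the factorials turns the binomial convolution into a Cauchy product.\<close>

lemma deg_bell_add:
  "deg_bell l k (a + b) / fact k =
     (\<Sum>i\<le>k. (deg_bell l i a / fact i) * (deg_bell l (k - i) b / fact (k - i)))"
  by (simp add: deg_bell_def fps_exp_add_mult fps_mult_nth atLeast0AtMost
      fps_compose_mult_distrib[OF deg_exp_fps_minus_1_nth_0])

lemma deg_bell_mass_add:
  "deg_bell_mass l (a + b) \<theta> k = (\<Sum>i\<le>k. deg_bell_mass l a \<theta> i * deg_bell_mass l b \<theta> (k - i))"
proof -
  define c where "c = deg_exp l 1 \<theta> - 1"
  have mass: "deg_bell_mass l x \<theta> j = exp (- x * c) * \<theta> ^ j * (deg_bell l j x / fact j)" for x j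
    by (simp add: deg_bell_mass_def c_def)
  have "exp (- (a + b) * c) = exp (- a * c) * exp (- b * c)"
    by (simp add: ring_distribs flip: exp_add)
  then have "deg_bell_mass l (a + b) \<theta> k = (\<Sum>i\<le>k. exp (- a * c) * exp (- b * c) * \<theta> ^ k *
      ((deg_bell l i a / fact i) * (deg_bell l (k - i) b / fact (k - i))))"
    unfolding mass deg_bell_add by (simp only: sum_distrib_left)
  also have "\<dots> = (\<Sum>i\<le>k. deg_bell_mass l a \<theta> i * deg_bell_mass l b \<theta> (k - i))"
  proof (intro sum.cong refl)
    fix i assume "i \<in> {..k}"
    \<comment> \<open>Subtraction on \<open>nat\<close> truncates, so the splitting of the power
      relies on \<open>i \<le> k\<close>.\<close>
    then have "\<theta> ^ k = \<theta> ^ i * \<theta> ^ (k - i)"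
      by (simp flip: power_add)
    then show "exp (- a * c) * exp (- b * c) * \<theta> ^ k *
        ((deg_bell l i a / fact i) * (deg_bell l (k - i) b / fact (k - i))) =
        deg_bell_mass l a \<theta> i * deg_bell_mass l b \<theta> (k - i)"
      unfolding mass by (simp only: mult_ac)
  qed
  finally show ?thesis .
qed

text \<open>Parameter 0 gives the point mass at 0, the law of an empty sum, because
  \<open>fps_exp 0\<close> is the constant series 1. This starts the induction over the index
  set.\<close>

lemma deg_bell_mass_0: "deg_bell_mass l 0 \<theta> k = (if k = 0 then 1 else 0)"
  by (simp add: deg_bell_mass_def deg_bell_def)

context prob_space
begin

lemma prob_add_nat:
  fixes X Y :: "'a \<Rightarrow> nat"
  assumes "indep_var (count_space UNIV) X (count_space UNIV) Y"
  shows "prob {\<omega> \<in> space M. X \<omega> + Y \<omega> = k} =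
    (\<Sum>i\<le>k. prob {\<omega> \<in> space M. X \<omega> = i} * prob {\<omega> \<in> space M. Y \<omega> = k - i})"
proof -
  note [measurable] = indep_var_rv1[OF assms] indep_var_rv2[OF assms]
  \<comment> \<open>The event is split by the value of \<open>X\<close>, which is at most
    \<open>k\<close>; the pieces are disjoint.\<close>
  have "{\<omega> \<in> space M. X \<omega> + Y \<omega> = k} = (\<Union>i\<le>k. {\<omega> \<in> space M. X \<omega> = i \<and> Y \<omega> = k - i})"
    by auto
  then have "prob {\<omega> \<in> space M. X \<omega> + Y \<omega> = k} =
      (\<Sum>i\<le>k. prob {\<omega> \<in> space M. X \<omega> = i \<and> Y \<omega> = k - i})"
    by (simp only:) (intro finite_measure_finite_Union, auto simp: disjoint_family_on_def)
  also have "\<dots> = (\<Sum>i\<le>k. prob {\<omega> \<in> space M. X \<omega> = i} * prob {\<omega> \<in> space M. Y \<omega> = k - i})"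
  proof (intro sum.cong refl)
    fix i
    show "prob {\<omega> \<in> space M. X \<omega> = i \<and> Y \<omega> = k - i} =
        prob {\<omega> \<in> space M. X \<omega> = i} * prob {\<omega> \<in> space M. Y \<omega> = k - i}"
      using indep_varD[OF assms, of "{i}" "{k - i}"]
      by (simp add: vimage_def Int_def conj_commute)
  qed
  finally show ?thesis .
qed

text \<open>Both variables are functions of restrictions of the family to the disjoint index sets
  \<open>{j}\<close> and \<open>I\<close>, and such restrictions are independent.\<close>

lemma indep_vars_sum_nat:
  fixes X :: "'i \<Rightarrow> 'a \<Rightarrow> nat"
  assumes "finite I" "j \<notin> I" and indep: "indep_vars (\<lambda>_. count_space UNIV) X (insert j I)"
  shows "indep_var (count_space UNIV) (X j) (count_space UNIV) (\<lambda>\<omega>. \<Sum>i\<in>I. X i \<omega>)"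
proof -
  have "indep_var
      (count_space UNIV) ((\<lambda>f. f j) \<circ> (\<lambda>\<omega>. restrict (\<lambda>i. X i \<omega>) {j}))
      (count_space UNIV) ((\<lambda>f. \<Sum>i\<in>I. f i) \<circ> (\<lambda>\<omega>. restrict (\<lambda>i. X i \<omega>) I))"
    using assms(1,2) by (intro indep_var_compose[OF indep_var_restrict[OF indep]]) auto
  then show ?thesis
    by (simp add: comp_def)
qed

text \<open>An arbitrary finite index set allows induction by inserting one index at a time.\<close>

lemma deg_bell_distributed_sum:
  fixes X :: "'i \<Rightarrow> 'a \<Rightarrow> nat"
  assumes "finite I" and "indep_vars (\<lambda>_. count_space UNIV) X I"
    and "\<And>i. i \<in> I \<Longrightarrow> deg_bell_distributed M (X i) l (\<alpha> i) \<theta>"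
  shows "deg_bell_distributed M (\<lambda>\<omega>. \<Sum>i\<in>I. X i \<omega>) l (\<Sum>i\<in>I. \<alpha> i) \<theta>"
  using assms
proof (induction I rule: finite_induct)
  case empty
  show ?case
    by (simp add: deg_bell_distributed_def deg_bell_mass_0 prob_space)
next
  case (insert j I)
  have "indep_vars (\<lambda>_. count_space UNIV) X I"
    using insert.prems(1) by (rule indep_vars_subset) auto
  then have IH: "deg_bell_distributed M (\<lambda>\<omega>. \<Sum>i\<in>I. X i \<omega>) l (\<Sum>i\<in>I. \<alpha> i) \<theta>"
    using insert by simp
  have Xj: "deg_bell_distributed M (X j) l (\<alpha> j) \<theta>"
    using insert.prems by simp
  have indep: "indep_var (count_space UNIV) (X j) (count_space UNIV) (\<lambda>\<omega>. \<Sum>i\<in>I. X i \<omega>)"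
    by (rule indep_vars_sum_nat[OF insert.hyps insert.prems(1)])
  note [measurable] = indep_var_rv1[OF indep] indep_var_rv2[OF indep]
  have "(\<lambda>\<omega>. X j \<omega> + (\<Sum>i\<in>I. X i \<omega>)) \<in> measurable M (count_space UNIV)"
    by measurable
  \<comment> \<open>The law of the sum is the convolution of the two laws, which
    \<open>deg_bell_mass_add\<close> evaluates.\<close>
  with prob_add_nat[OF indep] show ?case
    using IH Xj insert.hyps
    by (simp add: deg_bell_distributed_def deg_bell_mass_add)
qed

end

theorem theorem2:
  fixes M :: "'a measure" and X :: "nat \<Rightarrow> 'a \<Rightarrow> nat"
    and l \<theta> :: real and \<alpha> :: "nat \<Rightarrow> real" and n :: nat
  assumes "prob_space M"
    and "0 < l" and "l \<le> 1"
    and "n \<ge> 1"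
    and "prob_space.indep_vars M (\<lambda>_. count_space UNIV) X {1..n}"
    and "\<And>i. i \<in> {1..n} \<Longrightarrow> deg_bell_distributed M (X i) l (\<alpha> i) \<theta>"
  shows "deg_bell_distributed M (\<lambda>\<omega>. \<Sum>i=1..n. X i \<omega>) l (\<Sum>i=1..n. \<alpha> i) \<theta>"
  using assms(5,6) by (intro prob_space.deg_bell_distributed_sum[OF assms(1)]) auto

end
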